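(* Let $g,h$ be arithmetic functions with $g(1)=1$ and $0<h(n)\le h(n+1)$ for all $n\ge 1$, put $h(0):=0$, and let $P_n^{g,h}(x)$ be the associated polynomials. Let $0<\varepsilon<1$. Assume that the power series $$G_2(T)=\sum_{k=2}^{\infty}|g(k+1)-g(2)g(k)|\,T^k$$ has radius of convergence $R>0$ (possibly $R=\infty$). Let $0<T_\varepsilon<R$ be such that $G_2(T_\varepsilon)\le\varepsilon$, and put $$\kappa=\kappa_\varepsilon:=\frac{1}{1-\varepsilon}\left(\frac{1}{T_\varepsilon}+|g(2)|\right).$$ Then for all $n\ge 1$ and all $x\in\mathbb{C}$ with $|x|>\kappa\,h(n-1)$, $$\left|P_n^{g,h}(x)-\frac{x+g(2)h(n-1)}{h(n)}P_{n-1}^{g,h}(x)\right|<\varepsilon\,\frac{|x|}{h(n)}\left|P_{n-1}^{g,h}(x)\right|.$$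
   Context: An arithmetic function is a function on the positive integers; $g$ is complex-valued and $h$ is real-valued. The polynomials $P_n^{g,h}(x)$ are defined by $P_0^{g,h}(x)=1$ and, for $n\ge1$, $$P_n^{g,h}(x)=\frac{x}{h(n)}\sum_{k=1}^{n}g(k)\,P_{n-k}^{g,h}(x).$$ *)

theory Defs
  imports "HOL-Analysis.Analysis" "HOL-Computational_Algebra.Polynomial"
begin

(* Arithmetic functions are total functions on nat. The value g 0 is never used below,
   and h 0 is not used in the recursion for P. *)

fun P :: "(nat \<Rightarrow> complex) \<Rightarrow> (nat \<Rightarrow> real) \<Rightarrow> nat \<Rightarrow> complex poly" where
  "P g h 0 = 1"
| "P g h (Suc m) =
     [:0, 1 / complex_of_real (h (Suc m)):] *
       (\<Sum>k = 1..Suc m. smult (g k) (P g h (Suc m - k)))"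

definition G2_coeff :: "(nat \<Rightarrow> complex) \<Rightarrow> nat \<Rightarrow> real" where
  "G2_coeff g k = (if k \<ge> 2 then cmod (g (k + 1) - g 2 * g k) else 0)"

definition G2 :: "(nat \<Rightarrow> complex) \<Rightarrow> real \<Rightarrow> real" where
  "G2 g T = (\<Sum>k. G2_coeff g k * T ^ k)"

definition kappa :: "(nat \<Rightarrow> complex) \<Rightarrow> real \<Rightarrow> real \<Rightarrow> real" where
  "kappa g \<epsilon> T = 1 / (1 - \<epsilon>) * (1 / T + cmod (g 2))"

end

theory Submission
  imports Defs
begin

text \<open>
  Subtracting \<open>g 2\<close> times the recursion at \<open>n - 1\<close> from the recursion at \<open>n\<close> cancels the
  \<open>k = 2\<close> term and leaves \<open>x / h n\<close> times the sum of
  \<open>(g (k + 1) - g 2 * g k) * P (n - 1 - k)\<close>. By induction, the claimed estimate for all smaller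
  indices gives \<open>\<bar>P (m - 1)\<bar> < T * \<bar>P m\<bar>\<close> for \<open>m < n\<close>, by the choice of \<open>\<kappa>\<close>; hence the remaining sum
  is bounded by \<open>G2 T * \<bar>P (n - 1)\<bar>\<close>.
\<close>

lemma poly_P_Suc:
  "poly (P g h (Suc m)) x =
     x / complex_of_real (h (Suc m)) * (\<Sum>k = 1..Suc m. g k * poly (P g h (Suc m - k)) x)"
  by (simp add: poly_sum)

declare P.simps(2) [simp del]

lemma P_recurrence:
  assumes "g 1 = 1" "h 0 = 0" and pos: "\<And>n. n \<ge> 1 \<Longrightarrow> 0 < h n"
  shows "poly (P g h (Suc m)) x
      - (x + g 2 * complex_of_real (h m)) / complex_of_real (h (Suc m)) * poly (P g h m) x
    = x / complex_of_real (h (Suc m))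
        * (\<Sum>k = 1..m. (g (k + 1) - g 2 * g k) * poly (P g h (m - k)) x)"
proof -
  let ?p = "\<lambda>n. poly (P g h n) x"
  let ?A = "\<Sum>k = 1..m. g (k + 1) * ?p (m - k)"
  let ?B = "\<Sum>k = 1..m. g k * ?p (m - k)"
  \<comment> \<open>Split off the first term, whose coefficient is \<open>g 1 = 1\<close>, and shift
    the index of the rest by one.\<close>
  have shift: "(\<Sum>k = 1..Suc m. g k * ?p (Suc m - k)) = ?p m + ?A"
    using assms(1)
    by (simp add: sum.atLeast_Suc_atMost_Suc_shift sum.atLeast_Suc_atMost[of 0 m]
             del: sum.cl_ivl_Suc)
  \<comment> \<open>The recursion at \<open>m\<close>, cleared of its denominator. For
    \<open>m = 0\<close> both sides vanish, since \<open>h 0 = 0\<close> and \<open>?B\<close> is an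
    empty sum.\<close>
  have prev: "complex_of_real (h m) * ?p m = x * ?B"
  proof (cases m)
    case (Suc l)
    have "h (Suc l) \<noteq> 0"
      using pos[of "Suc l"] by simp
    then show ?thesis
      unfolding Suc poly_P_Suc by simp
  qed (simp add: assms(2))
  have "?p (Suc m) - (x + g 2 * complex_of_real (h m)) / complex_of_real (h (Suc m)) * ?p m
      = (x * ?A - g 2 * (complex_of_real (h m) * ?p m)) / complex_of_real (h (Suc m))"
    unfolding poly_P_Suc shift by (simp add: diff_divide_distrib add_divide_distrib algebra_simps)
  also have "\<dots> = x / complex_of_real (h (Suc m)) * (?A - g 2 * ?B)"
    unfolding prev by (simp add: right_diff_distrib diff_divide_distrib mult.left_commute)
  also have "?A - g 2 * ?B = (\<Sum>k = 1..m. (g (k + 1) - g 2 * g k) * ?p (m - k))"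
    by (simp add: left_diff_distrib sum_subtractf sum_distrib_left mult.assoc)
  finally show ?thesis .
qed

text \<open>At \<open>k = 1\<close> the difference is \<open>g 2 - g 2 * g 1 = 0\<close>, which
  agrees with the default value of \<open>G2_coeff\<close> below 2. So the series \<open>G2\<close>
  controls a sum that starts at \<open>k = 1\<close>.\<close>

lemma G2_coeff_eq:
  assumes "g 1 = 1" "k \<ge> 1"
  shows "cmod (g (k + 1) - g 2 * g k) = G2_coeff g k"
proof (cases "k = 1")
  case True
  then show ?thesis
    using assms by (simp add: G2_coeff_def numeral_2_eq_2)
qed (use assms in \<open>simp add: G2_coeff_def\<close>)

lemma G2_coeff_nonneg: "0 \<le> G2_coeff g k"
  by (simp add: G2_coeff_def)

text \<open>By the reverse triangle inequality, \<open>est\<close> bounds \<open>p (Suc l)\<close>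
  below by \<open>(cmod (x + g 2 * h l) - \<epsilon> * cmod x) / h (Suc l)\<close> times the norm of
  \<open>p l\<close>. The constant \<open>kappa\<close> is what makes this factor exceed
  \<open>1 / T\<close>.\<close>

lemma norm_P_ratio:
  fixes x :: complex
  assumes "0 < h (Suc l)" "0 \<le> h l" "h l \<le> h (Suc l)"
    and "0 < T" "\<epsilon> < 1"
    and x: "kappa g \<epsilon> T * h (Suc l) < cmod x"
    and est: "cmod (p (Suc l) - (x + g 2 * complex_of_real (h l)) / complex_of_real (h (Suc l)) * p l)
      < \<epsilon> * (cmod x / h (Suc l)) * cmod (p l)"
  shows "cmod (p l) < T * cmod (p (Suc l))"
proof -
  let ?H = "h (Suc l)"
  \<comment> \<open>If \<open>p l\<close> were zero, the right side of the strict inequality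
    \<open>est\<close> would be zero.\<close>
  have p: "0 < cmod (p l)"
    using est by auto
  have "(1 / T + cmod (g 2)) * ?H = (1 - \<epsilon>) * (kappa g \<epsilon> T * ?H)"
    using assms(5) by (simp add: kappa_def)
  also have "\<dots> < (1 - \<epsilon>) * cmod x"
    using x assms(5) by simp
  finally have "?H / T < (1 - \<epsilon>) * cmod x - cmod (g 2) * ?H"
    by (simp add: algebra_simps)
  also have "\<dots> \<le> (1 - \<epsilon>) * cmod x - cmod (g 2) * h l"
    using assms(3) by (simp add: mult_left_mono)
  also have "\<dots> \<le> cmod (x + g 2 * complex_of_real (h l)) - \<epsilon> * cmod x"
    using norm_diff_ineq[of x "g 2 * complex_of_real (h l)"] assms(2)
    by (simp add: norm_mult algebra_simps)
  finally have "?H / T * cmod (p l)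
      < (cmod (x + g 2 * complex_of_real (h l)) - \<epsilon> * cmod x) * cmod (p l)"
    using p by (rule mult_strict_right_mono)
  moreover have "cmod ((x + g 2 * complex_of_real (h l)) / complex_of_real ?H * p l)
      - \<epsilon> * (cmod x / ?H) * cmod (p l) < cmod (p (Suc l))"
    using est norm_triangle_ineq2[of "(x + g 2 * complex_of_real (h l)) / complex_of_real ?H * p l" "p (Suc l)"]
    by (simp add: norm_minus_commute)
  then have "cmod (x + g 2 * complex_of_real (h l)) / ?H * cmod (p l)
      - \<epsilon> * (cmod x / ?H) * cmod (p l) < cmod (p (Suc l))"
    using assms(1) by (simp only: norm_mult norm_divide norm_of_real abs_of_pos)
  then have "(cmod (x + g 2 * complex_of_real (h l)) - \<epsilon> * cmod x) * cmod (p l)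
      < ?H * cmod (p (Suc l))"
    using assms(1) by (simp add: field_simps)
  ultimately have "?H / T * cmod (p l) < ?H * cmod (p (Suc l))"
    by linarith
  then show ?thesis
    using assms(1,4) by (simp add: field_simps)
qed

text \<open>Iterate the one-step bound downwards from \<open>m\<close>. At \<open>k = 0\<close> the
  two sides coincide, so strictness starts at \<open>k = 1\<close>.\<close>

lemma geometric_growth:
  fixes a :: "nat \<Rightarrow> real"
  assumes "0 < T" "\<And>l. l < m \<Longrightarrow> a l < T * a (Suc l)" "1 \<le> k" "k \<le> m"
  shows "a (m - k) < T ^ k * a m"
  using assms(3,4)
proof (induction k rule: dec_induct)
  case base
  then show ?case
    using assms(2)[of "m - 1"] by simp
next
  case (step k)
  have "a (m - Suc k) < T * a (m - k)"
    using assms(2)[of "m - Suc k"] step.prems by (simp add: Suc_diff_Suc)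
  also have "\<dots> < T * (T ^ k * a m)"
    using step assms(1) by simp
  finally show ?case
    by (simp add: mult.assoc)
qed

lemma weighted_sum_strict_bound:
  fixes a c :: "nat \<Rightarrow> real"
  assumes "\<And>k. 0 \<le> c k" "0 < T" "summable (\<lambda>k. c k * T ^ k)" "(\<Sum>k. c k * T ^ k) \<le> \<epsilon>"
    and "0 < \<epsilon>" "0 < a m" "\<And>k. 1 \<le> k \<Longrightarrow> k \<le> m \<Longrightarrow> a (m - k) < T ^ k * a m"
  shows "(\<Sum>k = 1..m. c k * a (m - k)) < \<epsilon> * a m"
\<comment> \<open>Strictness has two sources: if all these coefficients vanish, the sum is
  \<open>0 < \<epsilon> * a m\<close>; otherwise a positive coefficient makes the termwise
  comparison strict.\<close>
proof (cases "\<forall>k\<in>{1..m}. c k = 0")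
  case True
  then show ?thesis
    using assms(5,6) by simp
next
  case False
  then obtain j where j: "j \<in> {1..m}" "c j \<noteq> 0"
    by blast
  then have "0 < c j"
    using assms(1)[of j] by simp
  then have "(\<Sum>k = 1..m. c k * a (m - k)) < (\<Sum>k = 1..m. c k * (T ^ k * a m))"
    using j assms(1,7)
    by (intro sum_strict_mono_ex1) (auto intro!: mult_left_mono bexI[of _ j] intro: less_imp_le)
  also have "\<dots> = (\<Sum>k = 1..m. c k * T ^ k) * a m"
    by (simp add: sum_distrib_right mult.assoc)
  also have "\<dots> \<le> \<epsilon> * a m"
  proof (intro mult_right_mono)
    have "(\<Sum>k = 1..m. c k * T ^ k) \<le> (\<Sum>k. c k * T ^ k)"
      using assms(1-3) by (intro sum_le_suminf) auto
    then show "(\<Sum>k = 1..m. c k * T ^ k) \<le> \<epsilon>"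
      using assms(4) by linarith
  qed (use assms(6) in simp)
  finally show ?thesis .
qed

theorem theorem3:
  fixes g :: "nat \<Rightarrow> complex" and h :: "nat \<Rightarrow> real"
    and \<epsilon> T\<^sub>\<epsilon> :: real and R :: ereal
  assumes "g 1 = 1"
    and "\<And>n. n \<ge> 1 \<Longrightarrow> 0 < h n \<and> h n \<le> h (n + 1)"
    and "h 0 = 0"
    and "0 < \<epsilon>" and "\<epsilon> < 1"
    and "conv_radius (G2_coeff g) = R" and "R > 0"
    and "0 < T\<^sub>\<epsilon>" and "ereal T\<^sub>\<epsilon> < R"
    and "G2 g T\<^sub>\<epsilon> \<le> \<epsilon>"
  shows "\<forall>n\<ge>1. \<forall>x::complex. cmod x > kappa g \<epsilon> T\<^sub>\<epsilon> * h (n - 1) \<longrightarrow>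
           cmod (poly (P g h n) x
                 - (x + g 2 * complex_of_real (h (n - 1))) / complex_of_real (h n)
                     * poly (P g h (n - 1)) x)
             < \<epsilon> * (cmod x / h n) * cmod (poly (P g h (n - 1)) x)"
proof (intro allI impI)
  have pos: "0 < h n" if "n \<ge> 1" for n
    using assms(2) that by blast
  have nonneg: "0 \<le> h n" for n
    using pos[of n] assms(3) by (cases n) auto
  have mono: "h i \<le> h j" if "i \<le> j" for i j
  proof (rule lift_Suc_mono_le[OF _ that])
    show "h n \<le> h (Suc n)" for n
      using assms(2)[of n] assms(3) nonneg[of 1] by (cases n) auto
  qed
  have kappa: "0 \<le> kappa g \<epsilon> T\<^sub>\<epsilon>"
    using assms(5,8) by (simp add: kappa_def)
  have summable: "summable (\<lambda>k. G2_coeff g k * T\<^sub>\<epsilon> ^ k)"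
    using assms(6,8,9) by (intro summable_in_conv_radius) auto
  fix n :: nat and x :: complex
  let ?p = "\<lambda>n. poly (P g h n) x"
  assume "1 \<le> n" "kappa g \<epsilon> T\<^sub>\<epsilon> * h (n - 1) < cmod x"
  then show "cmod (?p n - (x + g 2 * complex_of_real (h (n - 1))) / complex_of_real (h n) * ?p (n - 1))
      < \<epsilon> * (cmod x / h n) * cmod (?p (n - 1))"
  proof (induction n rule: less_induct)
    case (less n)
    then obtain m where n: "n = Suc m"
      by (cases n) auto
    \<comment> \<open>As \<open>kappa\<close> is nonnegative and \<open>h\<close> is monotone, the
      same \<open>x\<close> is admissible at every smaller index, so the induction hypothesis
      applies to it.\<close>
    have x: "kappa g \<epsilon> T\<^sub>\<epsilon> * h l < cmod x" if "l \<le> m" for l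
      using less.prems(2) mult_left_mono[OF mono[OF that] kappa] n by simp
    have ratio: "cmod (?p l) < T\<^sub>\<epsilon> * cmod (?p (Suc l))" if "l < m" for l
    proof (rule norm_P_ratio[where h = h and g = g and \<epsilon> = \<epsilon> and x = x])
      show "cmod (?p (Suc l) - (x + g 2 * complex_of_real (h l)) / complex_of_real (h (Suc l)) * ?p l)
          < \<epsilon> * (cmod x / h (Suc l)) * cmod (?p l)"
        using less.IH[of "Suc l"] that x[of l] n by simp
    qed (use pos nonneg mono x that assms(5,8) in auto)
    \<comment> \<open>A strict conclusion requires that \<open>x\<close> is not a root of
      \<open>P g h m\<close>: this follows from the last ratio bound, or from
      \<open>P g h 0 = 1\<close> when \<open>m = 0\<close>.\<close>
    have "0 < cmod (?p m)"
    proof (cases m)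
      case (Suc l)
      then have "0 < T\<^sub>\<epsilon> * cmod (?p m)"
        using ratio[of l] by (simp add: le_less_trans[OF norm_ge_zero])
      then show ?thesis
        using assms(8) by (simp add: zero_less_mult_iff)
    qed simp
    then have sum: "(\<Sum>k = 1..m. G2_coeff g k * cmod (?p (m - k))) < \<epsilon> * cmod (?p m)"
      using geometric_growth[of T\<^sub>\<epsilon> m "\<lambda>l. cmod (?p l)"] ratio summable assms(4,8,10)
      by (intro weighted_sum_strict_bound[where T = T\<^sub>\<epsilon>]) (auto simp: G2_coeff_nonneg G2_def)
    \<comment> \<open>At index 0 the lower bound on \<open>cmod x\<close> is
      \<open>kappa * h 0 = 0\<close>.\<close>
    have "0 < cmod x"
      using x[of 0] assms(3) by simp
    then have factor: "0 < cmod x / h n"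
      using pos[of n] n by simp
    have "cmod (?p n - (x + g 2 * complex_of_real (h (n - 1))) / complex_of_real (h n) * ?p (n - 1))
        = cmod x / h n * cmod (\<Sum>k = 1..m. (g (k + 1) - g 2 * g k) * ?p (m - k))"
      using P_recurrence[of g h m x] assms(1,3) pos nonneg[of n] n
      by (simp add: norm_mult norm_divide)
    also have "\<dots> \<le> cmod x / h n * (\<Sum>k = 1..m. G2_coeff g k * cmod (?p (m - k)))"
    proof (rule mult_left_mono)
      show "cmod (\<Sum>k = 1..m. (g (k + 1) - g 2 * g k) * ?p (m - k))
          \<le> (\<Sum>k = 1..m. G2_coeff g k * cmod (?p (m - k)))"
        using G2_coeff_eq[of g] assms(1) by (intro sum_norm_le) (simp add: norm_mult)
    qed (use factor in linarith)
    also have "\<dots> < cmod x / h n * (\<epsilon> * cmod (?p m))"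
      using sum factor by (rule mult_strict_left_mono)
    finally show ?case
      using n by (simp add: mult_ac)
  qed
qed

end
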